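(* Let $\{\nu^k\}$ be a sequence generated by the smoothing projected gradient (SPG) algorithm described in the context, applied with the smoothing function $\tilde\varphi_\mu^N$ to the problem $$\min_{\nu\in\mathcal{V}}\ \Big\{\varphi^N(\nu):=\max_{1\le i\le N}h(\nu,\xi^i)\Big\}.$$ Then any accumulation point $\nu^*$ of $\{\nu^k\}$ is a global minimizer of this problem.
   Context: $\Delta_d=\{x\in\mathbb{R}^d : \sum_{i=1}^d x_i=1,\ x\ge 0\}$. $\mathbb{S}_+^{d+1}$ is the cone of symmetric positive semidefinite $(d+1)\times(d+1)$ matrices; $\|\cdot\|$ is the Euclidean norm; $[t]_+=\max\{t,0\}$; $\langle M,N\rangle=\sum_{i,j}M_{i,j}N_{i,j}$. $\nu=(x,\alpha,q,\Lambda)$ and $\mathcal{V}=\Delta_d\times\mathbb{R}\times\mathbb{R}^{d+1}\times\mathbb{S}_+^{d+1}$; $P_{\mathcal{V}}$ is the Euclidean projection onto $\mathcal{V}$. $\Xi\subseteq\mathbb{R}^{d+1}$ is a convex compact set; elements are written $\xi=(\xi_B^\top,\xi_a)^\top$ with $\xi_B\in\mathbb{R}^d$, $\xi_a\in\mathbb{R}$; $\Xi_{[N]}=\{\xi^1,\dots,\xi^N\}$ are samples from $\Xi$. The vector $\hat\mu\in\mathbb{R}^{d+1}$ and the symmetric positive definite matrix $\hat\Sigma$ are the mean vector and covariance matrix of finitely many historical observations of the random vector $\xi$, all lying in $\Xi$ ($\hat\mu$ is unrelated to the smoothing parameter $\mu$). $\tau_1,\tau_2\ge 0$, $\beta\in(0,1)$,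 $\kappa_1>0$, $\kappa_2>0$. The function $\psi$ is $\psi(c)=|c|$ or $\psi(c)=c^2$ on $\mathbb{R}$; put $\tilde\psi_\mu(c)=\sqrt{c^2+\mu}$ in the first case and $\tilde\psi_\mu=\psi$ in the second. The function $h$ is $$h(\nu,\xi)=h_1(\nu)+\sqrt{\kappa_1}\,\big\|\hat\Sigma^{1/2}(q+2\Lambda\hat\mu)\big\|+\psi(\xi_a-\xi_B^\top x)-(\Lambda^\top\xi+q)^\top\xi+\frac{\tau_2}{1-\beta}\big[-x^\top\xi_B-\alpha\big]_+,$$ $$h_1(\nu)=\langle\kappa_2\hat\Sigma,\Lambda\rangle+(\Lambda^\top\hat\mu+q)^\top\hat\mu+\tau_1\|x\|^2+\tau_2\alpha.$$ The smoothing function is, for $\mu>0$, $$\tilde\varphi_\mu^N(\nu)=\mu\ln\sum_{i=1}^N e^{\tilde h_\mu(\nu,\xi^i)/\mu},$$ $$\tilde h_\mu(\nu,\xi)=h_1(\nu)+\sqrt{\kappa_1\,(q+2\Lambda\hat\mu)^\top\hat\Sigma\,(q+2\Lambda\hat\mu)+\mu}+\tilde\psi_\mu(\xi_a-\xi_B^\top x)-(\Lambda^\top\xi+q)^\top\xi+\frac{\tau_2\,\mu}{1-\beta}\ln\Big(1+e^{\frac{-x^\top\xi_B-\alpha}{\mu}}\Big).$$ SPG algorithm. Initialize step-size parameter $a_0\in(0,1)$, $\sigma,\rho,\omega\in(0,1)$, $\mu_0>0$, $\eta>0$, $\epsilon>0$, $\nu^0\in\mathcal{V}$ and a positive integer $n_0$.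 For $k\ge 0$: Step 1. If $\big\|P_{\mathcal{V}}[\nu^k-\nabla_\nu\tilde\varphi_{\mu_k}^N(\nu^k)]-\nu^k\big\|<\epsilon$, let $\nu^{k+1}=\nu^k$ and go to Step 3. Otherwise go to Step 2. Step 2. Let $y^{0,k}=\nu^k$. For $j\ge 0$ let $y^{j,k}(t)=P_{\mathcal{V}}\big[y^{j,k}-t\,\nabla_\nu\tilde\varphi_{\mu_k}^N(y^{j,k})\big]$ and $y^{j+1,k}=y^{j,k}(t_{j,k})$, where the step size $t_{j,k}=a_0\rho^{\gamma_{j,k}}$ is chosen by the Armijo line search, i.e. $\gamma_{j,k}$ is the smallest nonnegative integer such that $$\tilde\varphi_{\mu_k}^N(y^{j+1,k})\le\tilde\varphi_{\mu_k}^N(y^{j,k})+\sigma\big\langle\nabla_\nu\tilde\varphi_{\mu_k}^N(y^{j,k}),\,y^{j+1,k}-y^{j,k}\big\rangle.$$ If $j\ge n_0$ and $\|y^{j+1,k}-y^{j,k}\|/t_{j,k}<\eta\mu_k$, set $\nu^{k+1}=y^{j+1,k}$ and go to Step 3. Step 3. Choose $\mu_{k+1}$ with $0<\mu_{k+1}\le\omega\mu_k$.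
   Formalization: "Accumulation point" means a limit point of the set of iterates (infinitely many distinct iterates nearby), not the limit of any subsequence: with ε>0 fixed, a run that passes Step 1 forever is constant at a possibly non-minimizing point, so the subsequence reading is false. *)

theory Defs
  imports "HOL-Analysis.Analysis"
begin

text \<open>
  The space of dimension \<open>d + 1\<close> is indexed by \<open>'d option\<close>: a vector \<open>\<xi>\<close> splits into
  \<open>\<xi>\<^sub>B = (\<xi> $ Some i)\<^sub>i\<close> and \<open>\<xi>\<^sub>a = \<xi> $ None\<close>.
  The variable \<open>\<nu> = (x, \<alpha>, q, \<Lambda>)\<close> lives in a product of Euclidean spaces; its inner product and norm
  are the Euclidean ones, with the entrywise (Frobenius) inner product on matrices.
\<close>

type_synonym 'd rvec = "(real, 'd option) vec"
type_synonym 'd rmat = "((real, 'd option) vec, 'd option) vec"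
type_synonym 'd var = "(real, 'd) vec \<times> real \<times> 'd rvec \<times> 'd rmat"

definition part_B :: "'d::finite rvec \<Rightarrow> (real, 'd) vec" where
  "part_B \<xi> = (\<chi> i. \<xi> $ Some i)"

definition part_a :: "'d::finite rvec \<Rightarrow> real" where
  "part_a \<xi> = \<xi> $ None"

definition pos_semidef :: "real^'n^'n \<Rightarrow> bool" where
  "pos_semidef A \<longleftrightarrow> transpose A = A \<and> (\<forall>v. 0 \<le> v \<bullet> (A *v v))"

definition pos_def :: "real^'n^'n \<Rightarrow> bool" where
  "pos_def A \<longleftrightarrow> transpose A = A \<and> (\<forall>v. v \<noteq> 0 \<longrightarrow> 0 < v \<bullet> (A *v v))"

text \<open>The positive semidefinite square root (it is unique when \<open>A\<close> is positive semidefinite).\<close>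

definition mat_sqrt :: "real^'n^'n \<Rightarrow> real^'n^'n" where
  "mat_sqrt A = (SOME S. pos_semidef S \<and> S ** S = A)"

definition unit_simplex :: "(real^'d) set" where
  "unit_simplex = {x. (\<Sum>i\<in>UNIV. x $ i) = 1 \<and> (\<forall>i. 0 \<le> x $ i)}"

definition feasible :: "'d::finite var set" where
  "feasible = unit_simplex \<times> UNIV \<times> UNIV \<times> {\<Lambda>. pos_semidef \<Lambda>}"

definition sample_mean :: "nat \<Rightarrow> (nat \<Rightarrow> real^'n) \<Rightarrow> real^'n" where
  "sample_mean M \<zeta> = (1 / real M) *\<^sub>R (\<Sum>j=1..M. \<zeta> j)"

text \<open>
  The normalisation \<open>c\<close> is \<open>M\<close> for the empirical covariance and \<open>M - 1\<close> for the unbiased one.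
\<close>

definition sample_cov :: "real \<Rightarrow> nat \<Rightarrow> (nat \<Rightarrow> real^'n) \<Rightarrow> real^'n^'n" where
  "sample_cov c M \<zeta> =
     (\<chi> r s. (\<Sum>j=1..M. (\<zeta> j - sample_mean M \<zeta>) $ r * (\<zeta> j - sample_mean M \<zeta>) $ s) / c)"

datatype loss = Absolute | Quadratic

fun psi :: "loss \<Rightarrow> real \<Rightarrow> real" where
  "psi Absolute c = \<bar>c\<bar>"
| "psi Quadratic c = c\<^sup>2"

fun psi_smooth :: "loss \<Rightarrow> real \<Rightarrow> real \<Rightarrow> real" where
  "psi_smooth Absolute \<mu> c = sqrt (c\<^sup>2 + \<mu>)"
| "psi_smooth Quadratic \<mu> c = psi Quadratic c"

record 'd model =
  loss :: loss
  kappa1 :: real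
  kappa2 :: real
  tau1 :: real
  tau2 :: real
  beta :: real
  mu_hat :: "'d rvec"
  Sigma_hat :: "'d rmat"

fun h1 :: "'d::finite model \<Rightarrow> 'd var \<Rightarrow> real" where
  "h1 P (x, \<alpha>, q, \<Lambda>) =
     (kappa2 P *\<^sub>R Sigma_hat P) \<bullet> \<Lambda>
     + (transpose \<Lambda> *v mu_hat P + q) \<bullet> mu_hat P
     + tau1 P * (norm x)\<^sup>2
     + tau2 P * \<alpha>"

fun h :: "'d::finite model \<Rightarrow> 'd var \<Rightarrow> 'd rvec \<Rightarrow> real" where
  "h P (x, \<alpha>, q, \<Lambda>) \<xi> =
     h1 P (x, \<alpha>, q, \<Lambda>)
     + sqrt (kappa1 P) * norm (mat_sqrt (Sigma_hat P) *v (q + 2 *\<^sub>R (\<Lambda> *v mu_hat P)))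
     + psi (loss P) (part_a \<xi> - part_B \<xi> \<bullet> x)
     - (transpose \<Lambda> *v \<xi> + q) \<bullet> \<xi>
     + tau2 P / (1 - beta P) * max (- (x \<bullet> part_B \<xi>) - \<alpha>) 0"

fun h_smooth :: "'d::finite model \<Rightarrow> real \<Rightarrow> 'd var \<Rightarrow> 'd rvec \<Rightarrow> real" where
  "h_smooth P \<mu> (x, \<alpha>, q, \<Lambda>) \<xi> =
     h1 P (x, \<alpha>, q, \<Lambda>)
     + sqrt (kappa1 P * ((q + 2 *\<^sub>R (\<Lambda> *v mu_hat P))
                           \<bullet> (Sigma_hat P *v (q + 2 *\<^sub>R (\<Lambda> *v mu_hat P)))) + \<mu>)
     + psi_smooth (loss P) \<mu> (part_a \<xi> - part_B \<xi> \<bullet> x)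
     - (transpose \<Lambda> *v \<xi> + q) \<bullet> \<xi>
     + tau2 P * \<mu> / (1 - beta P) * ln (1 + exp ((- (x \<bullet> part_B \<xi>) - \<alpha>) / \<mu>))"

definition phi :: "'d::finite model \<Rightarrow> nat \<Rightarrow> (nat \<Rightarrow> 'd rvec) \<Rightarrow> 'd var \<Rightarrow> real" where
  "phi P N \<xi> \<nu> = Max ((\<lambda>i. h P \<nu> (\<xi> i)) ` {1..N})"

definition phi_smooth ::
    "'d::finite model \<Rightarrow> nat \<Rightarrow> (nat \<Rightarrow> 'd rvec) \<Rightarrow> real \<Rightarrow> 'd var \<Rightarrow> real" where
  "phi_smooth P N \<xi> \<mu> \<nu> = \<mu> * ln (\<Sum>i=1..N. exp (h_smooth P \<mu> \<nu> (\<xi> i) / \<mu>))"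

text \<open>
  The gradient of the smoothing function is taken in the product space with all matrices in the
  last component. Its skew-symmetric part there is irrelevant to the algorithm: the feasible set only
  contains symmetric matrices, so neither projections onto it nor inner products with
  differences of feasible points change when the gradient is replaced by its symmetric part.
\<close>

definition grad :: "('a::real_inner \<Rightarrow> real) \<Rightarrow> 'a \<Rightarrow> 'a" where
  "grad f x = (THE g. GDERIV f x :> g)"

definition proj_step :: "'a::euclidean_space set \<Rightarrow> ('a \<Rightarrow> real) \<Rightarrow> 'a \<Rightarrow> real \<Rightarrow> 'a" where
  "proj_step V f y t = closest_point V (y - t *\<^sub>R grad f y)"

definition armijo ::
    "'a::euclidean_space set \<Rightarrow> ('a \<Rightarrow> real) \<Rightarrow> real \<Rightarrow> 'a \<Rightarrow> real \<Rightarrow> bool" where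
  "armijo V f \<sigma> y t \<longleftrightarrow>
     f (proj_step V f y t) \<le> f y + \<sigma> * (grad f y \<bullet> (proj_step V f y t - y))"

text \<open>
  One run of the inner loop from \<open>u\<close> with result \<open>w\<close>: \<open>y\<close> and \<open>\<gamma>\<close> are the inner iterates and line search
  exponents, and \<open>J\<close> is the first index at which the exit test holds. In particular the loop exits.
\<close>

definition inner_loop ::
    "'a::euclidean_space set \<Rightarrow> ('a \<Rightarrow> real) \<Rightarrow> real \<Rightarrow> real \<Rightarrow> real \<Rightarrow> real \<Rightarrow> nat \<Rightarrow> real
      \<Rightarrow> 'a \<Rightarrow> 'a \<Rightarrow> bool" where
  "inner_loop V f a0 \<sigma> \<rho> \<eta> n0 \<mu> u w \<longleftrightarrow>
     (\<exists>(y :: nat \<Rightarrow> 'a) (\<gamma> :: nat \<Rightarrow> nat) J.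
        let t = (\<lambda>j. a0 * \<rho> ^ \<gamma> j);
            exit_test = (\<lambda>j. n0 \<le> j \<and> norm (y (Suc j) - y j) / t j < \<eta> * \<mu>)
        in y 0 = u
           \<and> (\<forall>j\<le>J. y (Suc j) = proj_step V f (y j) (t j)
                 \<and> armijo V f \<sigma> (y j) (t j)
                 \<and> (\<forall>g<\<gamma> j. \<not> armijo V f \<sigma> (y j) (a0 * \<rho> ^ g)))
           \<and> exit_test J \<and> (\<forall>j<J. \<not> exit_test j)
           \<and> w = y (Suc J))"

text \<open>
  \<open>F \<mu>\<close> is the smoothing function with parameter \<open>\<mu>\<close>, \<open>\<mu>\<close> and \<open>\<nu>\<close> are the sequences of smoothing
  parameters and of outer iterates. The tolerance \<open>\<epsilon>\<close> is the same for all \<open>k\<close>, so a run whose test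
  succeeds for all large \<open>k\<close> stalls: \<open>\<nu>\<close> is then eventually constant, at a point that need not be
  a minimizer. Such a run has a finite set of iterates, which has no accumulation point.
\<close>

definition spg_sequence ::
    "'a::euclidean_space set \<Rightarrow> (real \<Rightarrow> 'a \<Rightarrow> real) \<Rightarrow> real \<Rightarrow> real \<Rightarrow> real \<Rightarrow> real \<Rightarrow> real \<Rightarrow> real
      \<Rightarrow> nat \<Rightarrow> (nat \<Rightarrow> real) \<Rightarrow> (nat \<Rightarrow> 'a) \<Rightarrow> bool" where
  "spg_sequence V F a0 \<sigma> \<rho> \<omega> \<eta> \<epsilon> n0 \<mu> \<nu> \<longleftrightarrow>
     \<nu> 0 \<in> V \<and> 0 < \<mu> 0 \<and>
     (\<forall>k. (if norm (closest_point V (\<nu> k - grad (F (\<mu> k)) (\<nu> k)) - \<nu> k) < \<epsilon>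
           then \<nu> (Suc k) = \<nu> k
           else inner_loop V (F (\<mu> k)) a0 \<sigma> \<rho> \<eta> n0 (\<mu> k) (\<nu> k) (\<nu> (Suc k)))
          \<and> 0 < \<mu> (Suc k) \<and> \<mu> (Suc k) \<le> \<omega> * \<mu> k)"

definition global_minimizer :: "'a set \<Rightarrow> ('a \<Rightarrow> real) \<Rightarrow> 'a \<Rightarrow> bool" where
  "global_minimizer V f z \<longleftrightarrow> z \<in> V \<and> (\<forall>v\<in>V. f z \<le> f v)"

end

theory Submission
  imports Defs
begin

text \<open>
  Each smoothing function is convex and differentiable, and it converges to the objective uniformly
  as the smoothing parameter tends to \<open>0\<close>. An accumulation point of the iterates is the limit of
  infinitely many outputs \<open>w\<close> of the inner loop. For such an output, obtained from \<open>y\<close> with step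
  size \<open>t\<close>, the variational inequality of the projection and the exit test
  \<open>\<parallel>w - y\<parallel> / t < \<eta> \<mu>\<close> give \<open>\<langle>g, v - w\<rangle> \<ge> - \<eta> \<mu> \<parallel>v - w\<parallel>\<close> for the gradient \<open>g\<close> at \<open>y\<close> and all
  feasible \<open>v\<close>. By convexity \<open>v\<close> then cannot improve on \<open>y\<close> by more than
  \<open>\<eta> \<mu> \<parallel>v - w\<parallel> - \<langle>g, w - y\<rangle>\<close>, where \<open>\<langle>g, w - y\<rangle>\<close> is controlled by the Armijo condition; this bound
  vanishes in the limit.
\<close>

subsection \<open>Square roots of positive semidefinite matrices\<close>

lemma symmetric_matrix_inner:
  fixes A :: "real^'n^'n"
  assumes "transpose A = A"
  shows "x \<bullet> (A *v y) = (A *v x) \<bullet> y"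
  using dot_lmul_matrix[of x A y] transpose_matrix_vector[of A x] assms by simp

lemma symmetric_matrix_eigenvector_on_subspace:
  fixes A :: "real^'n^'n"
  assumes sym: "transpose A = A"
    and S: "subspace S" "\<And>x. x \<in> S \<Longrightarrow> A *v x \<in> S"
    and w: "w \<in> S" "w \<noteq> 0"
  obtains v c where "v \<in> S" "norm v = 1" "A *v v = c *\<^sub>R v"
proof -
  let ?K = "S \<inter> sphere 0 1"
  have "compact ?K"
    by (simp add: S(1) closed_Int_compact closed_subspace)
  moreover have "w /\<^sub>R norm w \<in> ?K"
    using w S(1) by (simp add: subspace_scale)
  moreover have "continuous_on ?K (\<lambda>v. v \<bullet> (A *v v))"
    by (intro continuous_intros linear_continuous_on linear_linear[THEN iffD1] matrix_vector_mul_linear)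
  ultimately obtain v where v: "v \<in> ?K" and max: "\<And>u. u \<in> ?K \<Longrightarrow> u \<bullet> (A *v u) \<le> v \<bullet> (A *v v)"
    using continuous_attains_sup[of ?K "\<lambda>v. v \<bullet> (A *v v)"] by blast
  define c where "c = v \<bullet> (A *v v)"
  have Q: "x \<bullet> (A *v x) \<le> c * (x \<bullet> x)" if "x \<in> S" for x
  proof (cases "x = 0")
    case False
    let ?u = "x /\<^sub>R norm x"
    have "?u \<in> ?K"
      using False that S(1) by (simp add: subspace_scale)
    then have "?u \<bullet> (A *v ?u) \<le> c"
      using max c_def by blast
    moreover have "?u \<bullet> (A *v ?u) = x \<bullet> (A *v x) / (norm x)\<^sup>2"
      by (simp add: matrix_vector_mult_scaleR power2_eq_square divide_simps)
    ultimately have "x \<bullet> (A *v x) / (norm x)\<^sup>2 \<le> c"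
      by simp
    then show ?thesis
      using False by (simp add: power2_norm_eq_inner pos_divide_le_eq)
  qed simp
  define u where "u = c *\<^sub>R v - A *v v"
  have uS: "u \<in> S"
    using v S by (simp add: u_def subspace_diff subspace_scale)
  have vv: "v \<bullet> v = 1"
    using v by (simp add: dot_square_norm)
  define D where "D = c * (u \<bullet> u) - u \<bullet> (A *v u)"
  have *: "0 \<le> 2 * t * (u \<bullet> u) + t\<^sup>2 * D" for t
  proof -
    let ?x = "v + t *\<^sub>R u"
    have "?x \<in> S"
      using v uS S(1) by (simp add: subspace_add subspace_scale)
    moreover have "c * (?x \<bullet> ?x) - ?x \<bullet> (A *v ?x)
        = c * (v \<bullet> v) - v \<bullet> (A *v v) + 2 * t * (u \<bullet> (c *\<^sub>R v - A *v v)) + t\<^sup>2 * D"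
      using symmetric_matrix_inner[OF sym, of v u]
      by (simp add: D_def matrix_vector_right_distrib matrix_vector_mult_scaleR inner_add_left
          inner_add_right inner_diff_right power2_eq_square inner_commute algebra_simps)
    ultimately show ?thesis
      using Q[of ?x] vv by (simp add: u_def[symmetric] c_def[symmetric])
  qed
  have "u \<bullet> u = 0"
  proof (rule ccontr)
    assume "u \<bullet> u \<noteq> 0"
    then have pos: "0 < u \<bullet> u" by simp
    define t where "t = - (u \<bullet> u) / (\<bar>D\<bar> + 1)"
    have "t < 0" using pos by (simp add: t_def)
    have "\<bar>t * D\<bar> \<le> u \<bullet> u"
    proof -
      have "\<bar>t * D\<bar> = (u \<bullet> u) * (\<bar>D\<bar> / (\<bar>D\<bar> + 1))"
        using pos by (simp add: t_def abs_mult)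
      also have "\<dots> \<le> (u \<bullet> u) * 1"
        by (intro mult_left_mono) auto
      finally show ?thesis by simp
    qed
    then have "0 < 2 * (u \<bullet> u) + t * D" using pos by linarith
    with \<open>t < 0\<close> have "t * (2 * (u \<bullet> u) + t * D) < 0"
      by (simp add: mult_neg_pos)
    with *[of t] show False by (simp add: algebra_simps power2_eq_square)
  qed
  then have "A *v v = c *\<^sub>R v" by (simp add: u_def)
  with v that show thesis by auto
qed

lemma symmetric_matrix_eigenbasis:
  fixes A :: "real^'n^'n"
  assumes sym: "transpose A = A"
  obtains B c where "finite B" "\<And>b. b \<in> B \<Longrightarrow> A *v b = c b *\<^sub>R b"
    "\<And>a b. a \<in> B \<Longrightarrow> b \<in> B \<Longrightarrow> a \<bullet> b = (if a = b then 1 else 0)"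
    "\<And>x. (\<Sum>b\<in>B. (b \<bullet> x) *\<^sub>R b) = x"
proof -
  define Q where "Q B \<longleftrightarrow> pairwise orthogonal B \<and> (\<forall>b\<in>B. norm b = 1 \<and> (\<exists>c. A *v b = c *\<^sub>R b))"
    for B :: "(real^'n) set"
  have bound: "finite B \<and> card B \<le> DIM(real^'n)" if "Q B" for B
    using that pairwise_orthogonal_independent[of B] independent_bound[of B] by (force simp: Q_def)
  have "Q {}" by (simp add: Q_def)
  then have "\<exists>B. Q B \<and> (\<forall>B'. Q B' \<longrightarrow> card B' \<le> card B)"
    by (rule ex_has_greatest_nat[where b = "Suc (DIM(real^'n))"])
      (use bound in \<open>blast intro: le_imp_less_Suc\<close>)
  then obtain B where B: "Q B" and max: "\<And>B'. Q B' \<Longrightarrow> card B' \<le> card B"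
    by auto
  have fin: "finite B" using bound B by blast
  obtain c where c: "\<And>b. b \<in> B \<Longrightarrow> A *v b = c b *\<^sub>R b"
    using B unfolding Q_def by metis
  have on: "a \<bullet> b = (if a = b then 1 else 0)" if "a \<in> B" "b \<in> B" for a b
    using B that by (auto simp: Q_def pairwise_def orthogonal_def norm_eq_1)
  define S where "S = {x. \<forall>b\<in>B. b \<bullet> x = 0}"
  have sub: "subspace S"
    by (auto simp: S_def subspace_def inner_add_right)
  have inv: "A *v x \<in> S" if "x \<in> S" for x
    using that c by (auto simp: S_def symmetric_matrix_inner[OF sym])
  have S0: "w = 0" if wS: "w \<in> S" for w
  proof (rule ccontr)
    assume "w \<noteq> 0"
    obtain v d where v: "v \<in> S" "norm v = 1" "A *v v = d *\<^sub>R v"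
      by (rule symmetric_matrix_eigenvector_on_subspace[OF sym sub inv wS \<open>w \<noteq> 0\<close>])
    then have "Q (insert v B)"
      using B by (auto simp: Q_def S_def pairwise_insert orthogonal_def inner_commute)
    moreover have "v \<notin> B" using v by (auto simp: S_def norm_eq_1)
    ultimately show False using max[of "insert v B"] fin by simp
  qed
  have "(\<Sum>b\<in>B. (b \<bullet> x) *\<^sub>R b) = x" for x
  proof -
    have "a \<bullet> (\<Sum>b\<in>B. (b \<bullet> x) *\<^sub>R b) = a \<bullet> x" if "a \<in> B" for a
      using that fin by (simp add: inner_sum_right on if_distrib cong: if_cong)
    then have "x - (\<Sum>b\<in>B. (b \<bullet> x) *\<^sub>R b) \<in> S"
      by (simp add: S_def inner_diff_right)
    from S0[OF this] show ?thesis by simp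
  qed
  with that[OF fin] c on show thesis by blast
qed

lemma pos_semidef_sqrt_exists:
  fixes A :: "real^'n^'n"
  assumes "pos_semidef A"
  shows "\<exists>S. pos_semidef S \<and> S ** S = A"
proof -
  have sym: "transpose A = A" and nonneg: "\<And>v. 0 \<le> v \<bullet> (A *v v)"
    using assms by (auto simp: pos_semidef_def)
  obtain B c where fin: "finite B" and c: "\<And>b. b \<in> B \<Longrightarrow> A *v b = c b *\<^sub>R b"
    and on: "\<And>a b. a \<in> B \<Longrightarrow> b \<in> B \<Longrightarrow> a \<bullet> b = (if a = b then 1 else 0)"
    and expand: "\<And>x. (\<Sum>b\<in>B. (b \<bullet> x) *\<^sub>R b) = x"
    by (rule symmetric_matrix_eigenbasis[OF sym]) blast
  have c0: "0 \<le> c b" if "b \<in> B" for b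
    using nonneg[of b] c[OF that] on[OF that that] by simp
  define S :: "real^'n^'n" where "S = (\<chi> i j. \<Sum>b\<in>B. sqrt (c b) * b $ i * b $ j)"
  have S: "S *v x = (\<Sum>b\<in>B. (sqrt (c b) * (b \<bullet> x)) *\<^sub>R b)" for x
  proof (subst vec_eq_iff, rule allI)
    fix i
    have "(S *v x) $ i = (\<Sum>j\<in>UNIV. \<Sum>b\<in>B. sqrt (c b) * b $ i * b $ j * x $ j)"
      by (simp add: S_def matrix_vector_mult_def sum_distrib_right)
    also have "\<dots> = (\<Sum>b\<in>B. \<Sum>j\<in>UNIV. sqrt (c b) * b $ i * b $ j * x $ j)"
      by (rule sum.swap)
    also have "\<dots> = (\<Sum>b\<in>B. (sqrt (c b) * (b \<bullet> x)) *\<^sub>R b) $ i"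
      by (simp add: inner_vec_def sum_distrib_left sum_distrib_right mult_ac)
    finally show "(S *v x) $ i = (\<Sum>b\<in>B. (sqrt (c b) * (b \<bullet> x)) *\<^sub>R b) $ i" .
  qed
  have "transpose S = S"
    by (simp add: S_def transpose_def vec_eq_iff mult_ac)
  moreover have "0 \<le> v \<bullet> (S *v v)" for v
    using c0 by (auto simp: S inner_sum_right inner_commute[of v] mult.assoc intro!: sum_nonneg)
  moreover have "S ** S = A"
  proof (subst matrix_eq, rule allI)
    fix x
    have "S ** S *v x = S *v (S *v x)"
      by (simp add: matrix_vector_mul_assoc)
    also have "\<dots> = (\<Sum>b\<in>B. (sqrt (c b) * (b \<bullet> (S *v x))) *\<^sub>R b)"
      by (rule S)
    also have "\<dots> = (\<Sum>b\<in>B. (b \<bullet> x) *\<^sub>R (A *v b))"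
    proof (rule sum.cong)
      fix b assume b: "b \<in> B"
      have "b \<bullet> (S *v x) = sqrt (c b) * (b \<bullet> x)"
        using b fin by (simp add: S inner_sum_right on if_distrib cong: if_cong)
      then show "(sqrt (c b) * (b \<bullet> (S *v x))) *\<^sub>R b = (b \<bullet> x) *\<^sub>R (A *v b)"
        using c0[OF b] c[OF b] by simp
    qed simp
    also have "\<dots> = A *v (\<Sum>b\<in>B. (b \<bullet> x) *\<^sub>R b)"
      by (simp add: linear_sum[OF matrix_vector_mul_linear] matrix_vector_mult_scaleR)
    finally show "S ** S *v x = A *v x"
      by (simp add: expand)
  qed
  ultimately show ?thesis
    by (auto simp: pos_semidef_def)
qed

lemma norm_mat_sqrt_mult:
  fixes A :: "real^'n^'n"
  assumes "pos_semidef A"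
  shows "(norm (mat_sqrt A *v z))\<^sup>2 = z \<bullet> (A *v z)"
proof -
  have S: "pos_semidef (mat_sqrt A)" "mat_sqrt A ** mat_sqrt A = A"
    using someI_ex[OF pos_semidef_sqrt_exists[OF assms]] by (simp_all add: mat_sqrt_def)
  then have "(mat_sqrt A *v z) \<bullet> (mat_sqrt A *v z) = z \<bullet> (mat_sqrt A *v (mat_sqrt A *v z))"
    by (simp add: symmetric_matrix_inner pos_semidef_def)
  with S show ?thesis
    by (simp add: matrix_vector_mul_assoc power2_norm_eq_inner)
qed

subsection \<open>Convergence of the algorithm for convex smoothing functions\<close>

lemma GDERIV_grad:
  fixes f :: "'a::euclidean_space \<Rightarrow> real"
  assumes "f differentiable at x"
  shows "GDERIV f x :> grad f x"
proof -
  obtain D where D: "(f has_derivative D) (at x)"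
    using assms by (auto simp: differentiable_def)
  interpret D: bounded_linear D
    using D by (rule has_derivative_bounded_linear)
  have "D = (\<lambda>v. v \<bullet> (\<Sum>b\<in>Basis. D b *\<^sub>R b))"
  proof
    fix v
    have "D v = D (\<Sum>b\<in>Basis. (v \<bullet> b) *\<^sub>R b)"
      by (simp add: euclidean_representation)
    then show "D v = v \<bullet> (\<Sum>b\<in>Basis. D b *\<^sub>R b)"
      by (simp add: D.sum D.scaleR inner_sum_right mult.commute)
  qed
  with D have ex: "GDERIV f x :> (\<Sum>b\<in>Basis. D b *\<^sub>R b)"
    by (simp add: gderiv_def)
  have unique: "g = g'" if "GDERIV f x :> g" "GDERIV f x :> g'" for g g'
  proof -
    have "(\<lambda>v. v \<bullet> g) = (\<lambda>v. v \<bullet> g')"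
      using that unfolding gderiv_def by (rule has_derivative_unique)
    then have "v \<bullet> (g - g') = 0" for v
      by (metis inner_diff_right right_minus_eq)
    then show ?thesis using inner_eq_zero_iff right_minus_eq by blast
  qed
  show ?thesis
    unfolding grad_def by (rule theI) (rule ex, rule unique[OF _ ex])
qed

lemma convex_on_above_gradient:
  fixes f :: "'a::euclidean_space \<Rightarrow> real"
  assumes "convex_on UNIV f" "f differentiable at y"
  shows "f v \<ge> f y + grad f y \<bullet> (v - y)"
proof -
  let ?l = "\<lambda>t::real. y + t *\<^sub>R (v - y)"
  have "convex_on UNIV (\<lambda>t. f (?l t))"
  proof (rule convex_onI)
    fix t a b :: real assume "0 < t" "t < 1"
    moreover have "?l ((1 - t) *\<^sub>R a + t *\<^sub>R b) = (1 - t) *\<^sub>R ?l a + t *\<^sub>R ?l b"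
      by (simp add: algebra_simps)
    ultimately show "f (?l ((1 - t) *\<^sub>R a + t *\<^sub>R b)) \<le> (1 - t) * f (?l a) + t * f (?l b)"
      using convex_onD[OF assms(1)] by simp
  qed simp
  moreover have "((\<lambda>t. f (?l t)) has_field_derivative grad f y \<bullet> (v - y)) (at 0)"
  proof -
    have "(?l has_derivative (\<lambda>t. t *\<^sub>R (v - y))) (at 0)"
      by (auto intro!: derivative_eq_intros)
    moreover have "(f has_derivative (\<lambda>u. u \<bullet> grad f y)) (at (?l 0))"
      using GDERIV_grad[OF assms(2)] by (simp add: gderiv_def)
    ultimately have "((\<lambda>t. f (?l t)) has_derivative (\<lambda>t. (t *\<^sub>R (v - y)) \<bullet> grad f y)) (at 0)"
      by (rule has_derivative_compose)
    then show ?thesis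
      by (simp add: has_field_derivative_def inner_commute mult_commute_abs)
  qed
  ultimately have "f (?l 1) - f (?l 0) \<ge> (grad f y \<bullet> (v - y)) * (1 - 0)"
    by (intro convex_on_imp_above_tangent[where A = UNIV]) auto
  then show ?thesis by simp
qed

text \<open>
  The Armijo condition bounds \<open>grad f y \<bullet> (w - y)\<close> from below by a difference of function values,
  so no bound on the gradients is needed.
\<close>

lemma inner_loop_exit_estimate:
  fixes V :: "'a::euclidean_space set"
  assumes V: "closed V" "convex V" "V \<noteq> {}"
    and f: "convex_on UNIV f" "\<And>x. f differentiable at x"
    and par: "a0 \<in> {0<..<1}" "0 < \<sigma>" "\<rho> \<in> {0<..<1}" "0 < \<eta>" "0 < \<mu>"
    and loop: "inner_loop V f a0 \<sigma> \<rho> \<eta> n0 \<mu> u w"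
  obtains y where "w \<in> V" "dist y w \<le> \<eta> * \<mu>"
    "\<And>v. v \<in> V \<Longrightarrow> f y + (f w - f y) / \<sigma> - \<eta> * \<mu> * norm (v - w) \<le> f v"
proof -
  obtain Y \<gamma> J where
    step: "Y (Suc J) = proj_step V f (Y J) (a0 * \<rho> ^ \<gamma> J)" and
    arm: "armijo V f \<sigma> (Y J) (a0 * \<rho> ^ \<gamma> J)" and
    small: "norm (Y (Suc J) - Y J) / (a0 * \<rho> ^ \<gamma> J) < \<eta> * \<mu>" and
    w: "w = Y (Suc J)"
    using loop by (auto simp: inner_loop_def Let_def)
  define y t where "y = Y J" and "t = a0 * \<rho> ^ \<gamma> J"
  have "0 < t" using par by (simp add: t_def)
  have "t \<le> 1 * 1"
    unfolding t_def using par by (intro mult_mono power_le_one) auto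
  define g where "g = grad f y"
  have wp: "w = closest_point V (y - t *\<^sub>R g)"
    using step by (simp add: w y_def t_def g_def proj_step_def)
  have "w \<in> V"
    using V by (simp add: wp closest_point_in_set)
  have small': "norm (w - y) < t * (\<eta> * \<mu>)"
    using small \<open>0 < t\<close> by (simp add: w y_def t_def[symmetric] divide_less_eq mult.commute)
  have "t * (\<eta> * \<mu>) \<le> 1 * (\<eta> * \<mu>)"
    using \<open>t \<le> 1 * 1\<close> par by (intro mult_right_mono) auto
  with small' have "dist y w \<le> \<eta> * \<mu>"
    by (simp add: dist_norm norm_minus_commute)
  moreover have "f y + (f w - f y) / \<sigma> - \<eta> * \<mu> * norm (v - w) \<le> f v" if "v \<in> V" for v
  proof -
    have "f w \<le> f y + \<sigma> * (g \<bullet> (w - y))"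
      using arm step by (simp add: armijo_def w y_def g_def)
    then have 1: "(f w - f y) / \<sigma> \<le> g \<bullet> (w - y)"
      using par by (simp add: divide_le_eq mult.commute)
    have "(y - t *\<^sub>R g - w) \<bullet> (v - w) \<le> 0"
      using closest_point_dot[OF V(2,1) that] by (simp add: wp)
    then have "- (t * (g \<bullet> (v - w))) \<le> (w - y) \<bullet> (v - w)"
      by (simp add: inner_diff_left)
    also have "\<dots> \<le> norm (w - y) * norm (v - w)"
      by (rule norm_cauchy_schwarz)
    also have "\<dots> \<le> t * (\<eta> * \<mu>) * norm (v - w)"
      using small' by (intro mult_right_mono) auto
    finally have "t * - (g \<bullet> (v - w)) \<le> t * (\<eta> * \<mu> * norm (v - w))"
      by (simp add: mult.assoc)
    then have 2: "- (g \<bullet> (v - w)) \<le> \<eta> * \<mu> * norm (v - w)"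
      using mult_le_cancel_left_pos[OF \<open>0 < t\<close>] by (rule iffD1[rotated])
    have "f y + g \<bullet> (v - y) \<le> f v"
      using convex_on_above_gradient[OF f] by (simp add: g_def)
    moreover have "g \<bullet> (v - y) = g \<bullet> (v - w) + g \<bullet> (w - y)"
      by (simp add: inner_diff_right)
    ultimately show ?thesis using 1 2 by linarith
  qed
  ultimately show thesis by (rule that[OF \<open>w \<in> V\<close>])
qed

lemma infinitely_many_new_values_near_limit_point:
  fixes \<nu> :: "nat \<Rightarrow> 'a::metric_space"
  assumes "z islimpt range \<nu>" "0 < e"
  obtains k where "n \<le> k" "dist (\<nu> (Suc k)) z < e" "\<nu> (Suc k) \<noteq> \<nu> k"
proof -
  have "infinite (range \<nu> \<inter> ball z e)"
    using assms by (simp add: islimpt_eq_infinite_ball)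
  then have "infinite (range \<nu> \<inter> ball z e - \<nu> ` {..n})"
    by simp
  then have "range \<nu> \<inter> ball z e - \<nu> ` {..n} \<noteq> {}"
    by (metis finite.emptyI)
  then obtain w where w: "w \<in> range \<nu>" "w \<in> ball z e" "w \<notin> \<nu> ` {..n}"
    by blast
  define m where "m = (LEAST m. \<nu> m = w)"
  have m: "\<nu> m = w"
    using w(1) unfolding m_def by (auto intro: LeastI)
  with w(3) have "n < m" by (auto simp: not_le[symmetric])
  then obtain k where k: "m = Suc k" "n \<le> k"
    using less_imp_Suc_add[of n m] by auto
  have "\<nu> k \<noteq> w"
    using not_less_Least[of k "\<lambda>m. \<nu> m = w"] k(1) by (simp add: m_def[symmetric])
  with that[of k] k m w(2) show thesis
    by (simp add: dist_commute)
qed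

theorem spg_accumulation_point_minimizes:
  fixes V :: "'a::euclidean_space set"
  assumes V: "closed V" "convex V"
    and F: "\<And>m. 0 < m \<Longrightarrow> convex_on UNIV (F m)" "\<And>m x. 0 < m \<Longrightarrow> F m differentiable at x"
    and approx: "\<And>m x. 0 < m \<Longrightarrow> \<bar>F m x - f x\<bar> \<le> E m"
    and E: "(E \<longlongrightarrow> 0) (at_right 0)"
    and par: "a0 \<in> {0<..<1}" "\<sigma> \<in> {0<..<1}" "\<rho> \<in> {0<..<1}" "\<omega> \<in> {0<..<1}" "0 < \<eta>"
    and generated: "spg_sequence V F a0 \<sigma> \<rho> \<omega> \<eta> \<epsilon> n0 \<mu> \<nu>"
    and limpt: "z islimpt range \<nu>"
  shows "global_minimizer V f z"
proof -
  have nu0: "\<nu> 0 \<in> V" and mu0: "0 < \<mu> 0"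
    and step: "\<And>k. \<nu> (Suc k) = \<nu> k \<or> inner_loop V (F (\<mu> k)) a0 \<sigma> \<rho> \<eta> n0 (\<mu> k) (\<nu> k) (\<nu> (Suc k))"
    and mu_step: "\<And>k. 0 < \<mu> (Suc k) \<and> \<mu> (Suc k) \<le> \<omega> * \<mu> k"
    using generated unfolding spg_sequence_def by (auto, meson)
  have "V \<noteq> {}" using nu0 by blast
  have mu_pos: "0 < \<mu> k" for k
    using mu0 mu_step by (cases k) auto
  have exit: "\<nu> (Suc k) \<in> V \<and> (\<exists>y. dist y (\<nu> (Suc k)) \<le> \<eta> * \<mu> k \<and>
      (\<forall>v\<in>V. F (\<mu> k) y + (F (\<mu> k) (\<nu> (Suc k)) - F (\<mu> k) y) / \<sigma> - \<eta> * \<mu> k * norm (v - \<nu> (Suc k))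
          \<le> F (\<mu> k) v))"
    if "\<nu> (Suc k) \<noteq> \<nu> k" for k
  proof -
    have loop: "inner_loop V (F (\<mu> k)) a0 \<sigma> \<rho> \<eta> n0 (\<mu> k) (\<nu> k) (\<nu> (Suc k))"
      using step[of k] that by blast
    have "0 < \<sigma>" using par(2) by simp
    obtain y where "\<nu> (Suc k) \<in> V" "dist y (\<nu> (Suc k)) \<le> \<eta> * \<mu> k"
      "\<And>v. v \<in> V \<Longrightarrow> F (\<mu> k) y + (F (\<mu> k) (\<nu> (Suc k)) - F (\<mu> k) y) / \<sigma>
        - \<eta> * \<mu> k * norm (v - \<nu> (Suc k)) \<le> F (\<mu> k) v"
      using inner_loop_exit_estimate[OF V \<open>V \<noteq> {}\<close> F(1)[OF mu_pos] F(2)[OF mu_pos]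
            par(1) \<open>0 < \<sigma>\<close> par(3,5) mu_pos loop] by blast
    then show ?thesis
      by (intro conjI exI[of _ y] ballI)
  qed
  have "\<nu> k \<in> V" for k
  proof (induction k)
    case (Suc k)
    then show ?case using exit[of k] by (cases "\<nu> (Suc k) = \<nu> k") auto
  qed (rule nu0)
  then have "z islimpt V"
    by (intro islimpt_subset[OF limpt]) auto
  then have "z \<in> V"
    using V(1) by (simp add: closed_limpt)
  have "\<mu> \<longlonglongrightarrow> 0"
  proof (rule Lim_null_comparison)
    have "\<mu> k \<le> \<mu> 0 * \<omega> ^ k" for k
    proof (induction k)
      case (Suc k)
      have "\<mu> (Suc k) \<le> \<omega> * \<mu> k" using mu_step by blast
      also have "\<dots> \<le> \<omega> * (\<mu> 0 * \<omega> ^ k)"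
        using Suc par by (intro mult_left_mono) auto
      finally show ?case by (simp add: mult_ac)
    qed simp
    then show "\<forall>\<^sub>F k in sequentially. norm (\<mu> k) \<le> \<mu> 0 * \<omega> ^ k"
      using mu_pos by (simp add: less_imp_le)
    have "(\<lambda>k. \<mu> 0 * \<omega> ^ k) \<longlonglongrightarrow> \<mu> 0 * 0"
      using par by (intro tendsto_intros LIMSEQ_power_zero) auto
    then show "(\<lambda>k. \<mu> 0 * \<omega> ^ k) \<longlonglongrightarrow> 0" by simp
  qed
  have "\<exists>k. n \<le> k \<and> dist (\<nu> (Suc k)) z < inverse (real (Suc n)) \<and> \<nu> (Suc k) \<noteq> \<nu> k" for n
    using infinitely_many_new_values_near_limit_point[OF limpt, of "inverse (real (Suc n))" n]
    by (metis inverse_positive_iff_positive of_nat_0_less_iff zero_less_Suc)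
  then obtain r where r: "\<And>n. n \<le> r n" "\<And>n. dist (\<nu> (Suc (r n))) z < inverse (real (Suc n))"
    "\<And>n. \<nu> (Suc (r n)) \<noteq> \<nu> (r n)"
    by metis
  define w m where "w n = \<nu> (Suc (r n))" and "m n = \<mu> (r n)" for n
  have "filterlim r at_top sequentially"
    using r(1) by (auto simp: filterlim_at_top eventually_sequentially intro: order_trans)
  with \<open>\<mu> \<longlonglongrightarrow> 0\<close> have m0: "m \<longlonglongrightarrow> 0"
    unfolding m_def by (rule filterlim_compose)
  have m_pos: "0 < m n" for n by (simp add: m_def mu_pos)
  have wz: "w \<longlonglongrightarrow> z"
  proof (subst tendsto_dist_iff, rule Lim_null_comparison)
    show "\<forall>\<^sub>F n in sequentially. norm (dist (w n) z) \<le> inverse (real (Suc n))"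
      using r(2) by (auto simp: w_def less_imp_le)
  qed (rule LIMSEQ_inverse_real_of_nat)
  obtain y where y: "\<And>n. dist (y n) (w n) \<le> \<eta> * m n"
    and ineq: "\<And>n v. v \<in> V \<Longrightarrow> F (m n) (y n) + (F (m n) (w n) - F (m n) (y n)) / \<sigma>
      - \<eta> * m n * norm (v - w n) \<le> F (m n) v"
    using exit[OF r(3)] unfolding w_def m_def by metis
  have yz: "y \<longlonglongrightarrow> z"
  proof (rule Lim_transform[OF wz], rule Lim_null_comparison)
    show "\<forall>\<^sub>F n in sequentially. norm (y n - w n) \<le> \<eta> * m n"
      using y by (simp add: dist_norm)
    show "(\<lambda>n. \<eta> * m n) \<longlonglongrightarrow> 0"
      using tendsto_mult_left[OF m0, of \<eta>] by simp
  qed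
  have "filterlim m (at_right 0) sequentially"
    using m0 m_pos by (auto simp: filterlim_at intro!: always_eventually less_imp_neq[symmetric])
  with E have Em: "(\<lambda>n. E (m n)) \<longlonglongrightarrow> 0"
    by (rule filterlim_compose)
  have cont_f: "continuous_on UNIV f"
  proof (rule uniform_limit_theorem)
    show "\<forall>\<^sub>F n in sequentially. continuous_on UNIV (F (m n))"
      using F(2)[OF m_pos]
      by (intro always_eventually allI differentiable_imp_continuous_on) (simp add: differentiable_on_def)
    show "uniform_limit UNIV (\<lambda>n. F (m n)) f sequentially"
    proof (rule uniform_limitI)
      fix e :: real assume "0 < e"
      from order_tendstoD(2)[OF Em this]
      show "\<forall>\<^sub>F n in sequentially. \<forall>x\<in>UNIV. dist (F (m n) x) (f x) < e"
        by eventually_elim (auto simp: dist_real_def intro: le_less_trans[OF approx[OF m_pos]])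
    qed
  qed simp
  have lim: "(\<lambda>n. F (m n) (x n)) \<longlonglongrightarrow> f l" if "x \<longlonglongrightarrow> l" for x l
  proof -
    have "(\<lambda>n. F (m n) (x n) - f (x n)) \<longlonglongrightarrow> 0"
      by (rule Lim_null_comparison[OF _ Em]) (use approx[OF m_pos] in auto)
    moreover have "(\<lambda>n. f (x n)) \<longlonglongrightarrow> f l"
      using cont_f that by (metis UNIV_I continuous_on_tendsto_compose eventually_sequentiallyI)
    ultimately show ?thesis
      using tendsto_add by fastforce
  qed
  have "f z \<le> f v" if "v \<in> V" for v
  proof (rule LIMSEQ_le)
    have "(\<lambda>n. F (m n) (y n) + (F (m n) (w n) - F (m n) (y n)) / \<sigma> - \<eta> * m n * norm (v - w n))
        \<longlonglongrightarrow> f z + (f z - f z) / \<sigma> - \<eta> * 0 * norm (v - z)"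
      using par by (intro tendsto_intros lim yz wz m0) auto
    then show "(\<lambda>n. F (m n) (y n) + (F (m n) (w n) - F (m n) (y n)) / \<sigma> - \<eta> * m n * norm (v - w n))
        \<longlonglongrightarrow> f z"
      by simp
    show "(\<lambda>n. F (m n) v) \<longlonglongrightarrow> f v"
      by (rule lim) simp
  qed (use ineq[OF that] in blast)
  with \<open>z \<in> V\<close> show ?thesis
    by (simp add: global_minimizer_def)
qed

subsection \<open>Smooth convex functions\<close>

definition smooth_convex :: "('a::euclidean_space \<Rightarrow> real) \<Rightarrow> bool" where
  "smooth_convex f \<longleftrightarrow> convex_on UNIV f \<and> (\<forall>x. f differentiable at x)"

lemma smooth_convex_linear:
  assumes "linear f"
  shows "smooth_convex f"
  unfolding smooth_convex_def
proof (intro conjI allI convex_onI)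
  show "f differentiable at x" for x
    using assms by (simp add: linear_imp_differentiable)
qed (use assms in \<open>simp_all add: linear_add linear_scale\<close>)

lemma smooth_convex_add:
  assumes "smooth_convex f" "smooth_convex g"
  shows "smooth_convex (\<lambda>x. f x + g x)"
  using assms by (auto simp: smooth_convex_def)

lemma smooth_convex_cmul:
  assumes "smooth_convex f" "0 \<le> c"
  shows "smooth_convex (\<lambda>x. c * f x)"
  using assms by (auto simp: smooth_convex_def)

lemma smooth_convex_compose_affine:
  fixes g :: "'b::euclidean_space \<Rightarrow> real" and l :: "'a::euclidean_space \<Rightarrow> 'b"
  assumes "smooth_convex g" and l: "linear l"
  shows "smooth_convex (\<lambda>x. g (l x + c))"
  unfolding smooth_convex_def
proof (intro conjI allI convex_onI)
  fix t :: real and x y :: 'a assume "0 < t" "t < 1"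
  moreover have "l ((1 - t) *\<^sub>R x + t *\<^sub>R y) + c = (1 - t) *\<^sub>R (l x + c) + t *\<^sub>R (l y + c)"
    by (simp add: linear_add[OF l] linear_diff[OF l] linear_scale[OF l] algebra_simps)
  ultimately show "g (l ((1 - t) *\<^sub>R x + t *\<^sub>R y) + c) \<le> (1 - t) * g (l x + c) + t * g (l y + c)"
    using assms(1) convex_onD[of UNIV g t] by (simp add: smooth_convex_def)
next
  fix x
  have "(\<lambda>x. l x + c) differentiable at x"
    using linear_imp_differentiable[OF l] by simp
  with assms(1) show "(\<lambda>x. g (l x + c)) differentiable at x"
    unfolding smooth_convex_def by (intro differentiable_compose[of g "\<lambda>x. l x + c"]) auto
qed simp

lemma smooth_convex_norm_power2:
  "smooth_convex (\<lambda>x::'a::euclidean_space. (norm x)\<^sup>2)"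
  unfolding smooth_convex_def
proof (intro conjI allI convex_onI)
  fix t :: real and x y :: 'a assume "0 < t" "t < 1"
  have "(1 - t) * (norm x)\<^sup>2 + t * (norm y)\<^sup>2 - (norm ((1 - t) *\<^sub>R x + t *\<^sub>R y))\<^sup>2
      = t * (1 - t) * (norm (x - y))\<^sup>2"
    by (simp add: power2_norm_eq_inner inner_add_left inner_add_right inner_diff_left
        inner_diff_right inner_commute algebra_simps)
  moreover have "0 \<le> t * (1 - t) * (norm (x - y))\<^sup>2"
    using \<open>0 < t\<close> \<open>t < 1\<close> by simp
  ultimately show "(norm ((1 - t) *\<^sub>R x + t *\<^sub>R y))\<^sup>2 \<le> (1 - t) * (norm x)\<^sup>2 + t * (norm y)\<^sup>2"
    by linarith
next
  fix x :: 'a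
  show "(\<lambda>x. (norm x)\<^sup>2) differentiable at x"
    unfolding power2_norm_eq_inner by simp
qed simp

text \<open>\<open>sqrt (\<parallel>x\<parallel>\<^sup>2 + m)\<close> is the norm of the vector \<open>(x, sqrt m)\<close>.\<close>

lemma smooth_convex_sqrt_norm_power2_add:
  assumes "0 < m"
  shows "smooth_convex (\<lambda>x::'a::euclidean_space. sqrt ((norm x)\<^sup>2 + m))"
  unfolding smooth_convex_def
proof (intro conjI allI convex_onI)
  have eq: "sqrt ((norm z)\<^sup>2 + m) = norm (z, sqrt m)" for z :: 'a
    using assms by (simp add: norm_Pair)
  fix t :: real and x y :: 'a assume t: "0 < t" "t < 1"
  have "((1 - t) *\<^sub>R x + t *\<^sub>R y, sqrt m) = (1 - t) *\<^sub>R (x, sqrt m) + t *\<^sub>R (y, sqrt m)"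
    by (simp add: algebra_simps)
  also have "norm \<dots> \<le> norm ((1 - t) *\<^sub>R (x, sqrt m)) + norm (t *\<^sub>R (y, sqrt m))"
    by (rule norm_triangle_ineq)
  also have "\<dots> = (1 - t) * norm (x, sqrt m) + t * norm (y, sqrt m)"
    using t by (simp only: norm_scaleR abs_of_pos diff_gt_0_iff_gt)
  finally show "sqrt ((norm ((1 - t) *\<^sub>R x + t *\<^sub>R y))\<^sup>2 + m)
      \<le> (1 - t) * sqrt ((norm x)\<^sup>2 + m) + t * sqrt ((norm y)\<^sup>2 + m)"
    by (simp only: eq)
next
  fix x :: 'a
  have "(norm x)\<^sup>2 + m > 0" using assms by (simp add: add_nonneg_pos)
  then have "sqrt differentiable at ((norm x)\<^sup>2 + m)"
    using DERIV_real_sqrt real_differentiable_def by blast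
  moreover have "(\<lambda>x. (norm x)\<^sup>2 + m) differentiable at x"
    using smooth_convex_norm_power2[where ?'a = 'a] by (simp add: smooth_convex_def)
  ultimately show "(\<lambda>x. sqrt ((norm x)\<^sup>2 + m)) differentiable at x"
    by (rule differentiable_compose)
qed simp

lemma smooth_convex_softplus:
  assumes "0 < m"
  shows "smooth_convex (\<lambda>s::real. m * ln (1 + exp (s / m)))"
proof -
  have pos: "0 < 1 + exp (s / m)" for s
    using exp_gt_zero[of "s / m"] by linarith
  have D: "((\<lambda>s. m * ln (1 + exp (s / m))) has_real_derivative 1 - 1 / (1 + exp (s / m))) (at s)" for s
  proof -
    have "1 - 1 / (1 + exp (s / m)) = m * (exp (s / m) / m / (1 + exp (s / m)))"
      using assms pos[of s] by (simp add: diff_divide_eq_iff)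
    then show ?thesis
      using assms pos[of s] by (auto intro!: derivative_eq_intros)
  qed
  have "convex_on UNIV (\<lambda>s. m * ln (1 + exp (s / m)))"
  proof (rule convex_on_realI[OF _ D])
    fix x y :: real assume "x \<le> y"
    then have "1 + exp (x / m) \<le> 1 + exp (y / m)"
      using assms by (simp add: divide_right_mono)
    then show "1 - 1 / (1 + exp (x / m)) \<le> 1 - 1 / (1 + exp (y / m))"
      using pos[of x] by (intro diff_mono frac_le) auto
  qed simp
  then show ?thesis
    using D real_differentiable_def by (auto simp: smooth_convex_def)
qed

text \<open>
  Convexity of log-sum-exp: convexity of \<open>exp\<close> is applied to the summands after normalising both
  families of exponentials to total mass \<open>1\<close>.
\<close>

lemma smooth_convex_log_sum_exp:
  fixes f :: "'i \<Rightarrow> 'a::euclidean_space \<Rightarrow> real"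
  assumes I: "finite I" "I \<noteq> {}" and m: "0 < m" and f: "\<And>i. i \<in> I \<Longrightarrow> smooth_convex (f i)"
  shows "smooth_convex (\<lambda>x. m * ln (\<Sum>i\<in>I. exp (f i x / m)))"
proof -
  define A where "A x = (\<Sum>i\<in>I. exp (f i x / m))" for x
  have A: "0 < A x" for x
    unfolding A_def using I by (intro sum_pos) auto
  have mass: "(\<Sum>i\<in>I. exp (f i x / m - ln (A x))) = 1" for x
    using A[of x] by (simp add: exp_diff sum_divide_distrib[symmetric] A_def[symmetric])
  have "convex_on UNIV (\<lambda>x. ln (A x))"
  proof (rule convex_onI)
    fix t :: real and x y :: 'a assume t: "0 < t" "t < 1"
    define L where "L = (1 - t) * ln (A x) + t * ln (A y)"
    let ?z = "(1 - t) *\<^sub>R x + t *\<^sub>R y"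
    have "A ?z / exp L = (\<Sum>i\<in>I. exp (f i ?z / m - L))"
      by (simp add: A_def exp_diff sum_divide_distrib)
    also have "\<dots> \<le> (\<Sum>i\<in>I. (1 - t) * exp (f i x / m - ln (A x)) + t * exp (f i y / m - ln (A y)))"
    proof (rule sum_mono)
      fix i assume "i \<in> I"
      then have "f i ?z \<le> (1 - t) * f i x + t * f i y"
        using f t convex_onD[of UNIV "f i" t x y] by (simp add: smooth_convex_def)
      then have "f i ?z / m \<le> ((1 - t) * f i x + t * f i y) / m"
        using m by (intro divide_right_mono) auto
      also have "\<dots> = (1 - t) * (f i x / m) + t * (f i y / m)"
        by (simp add: add_divide_distrib)
      finally have "f i ?z / m - L \<le> (1 - t) * (f i x / m - ln (A x)) + t * (f i y / m - ln (A y))"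
        unfolding L_def right_diff_distrib by linarith
      then have "exp (f i ?z / m - L)
          \<le> exp ((1 - t) *\<^sub>R (f i x / m - ln (A x)) + t *\<^sub>R (f i y / m - ln (A y)))"
        by simp
      also have "\<dots> \<le> (1 - t) * exp (f i x / m - ln (A x)) + t * exp (f i y / m - ln (A y))"
        using t by (intro convex_onD[OF exp_convex]) auto
      finally show "exp (f i ?z / m - L) \<le> \<dots>" .
    qed
    also have "\<dots> = 1"
      by (simp add: sum.distrib sum_distrib_left[symmetric] mass)
    finally have "A ?z \<le> exp L" by simp
    with A show "ln (A ?z) \<le> (1 - t) * ln (A x) + t * ln (A y)"
      by (metis L_def ln_exp ln_le_cancel_iff exp_gt_zero)
  qed simp
  then have "convex_on UNIV (\<lambda>x. m * ln (A x))"
    using m by (intro convex_on_cmul) auto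
  moreover have "(\<lambda>x. m * ln (A x)) differentiable at x" for x
  proof -
    have "(\<lambda>x. exp (f i x / m)) differentiable at x" if "i \<in> I" for i
    proof (rule differentiable_compose[of exp])
      show "exp differentiable at (f i x / m)"
        using DERIV_exp real_differentiable_def by blast
      have "(\<lambda>x. inverse m * f i x) differentiable at x"
        using f[OF that] by (simp add: smooth_convex_def)
      then show "(\<lambda>x. f i x / m) differentiable at x"
        by (simp add: divide_inverse mult.commute)
    qed
    then have "A differentiable at x"
      unfolding A_def using I by (simp add: differentiable_sum)
    moreover have "ln differentiable at (A x)"
      using A[of x] DERIV_ln real_differentiable_def by blast
    ultimately have "(\<lambda>x. ln (A x)) differentiable at x"
      by (rule differentiable_compose[rotated])
    then show ?thesis by simp
  qed
  ultimately show ?thesis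
    by (simp add: smooth_convex_def A_def)
qed

lemma log_sum_exp_bounds:
  fixes a :: "'i \<Rightarrow> real"
  assumes I: "finite I" "I \<noteq> {}" and m: "0 < m"
  shows "Max (a ` I) \<le> m * ln (\<Sum>i\<in>I. exp (a i / m))"
    and "m * ln (\<Sum>i\<in>I. exp (a i / m)) \<le> Max (a ` I) + m * ln (card I)"
proof -
  let ?S = "\<Sum>i\<in>I. exp (a i / m)" and ?M = "Max (a ` I)"
  have S: "0 < ?S"
    using I by (intro sum_pos) auto
  obtain j where j: "j \<in> I" "a j = ?M"
    using Max_in[of "a ` I"] I by (metis (no_types, lifting) finite_imageI image_iff image_is_empty)
  have "exp (?M / m) \<le> ?S"
    using I j member_le_sum[of j I "\<lambda>i. exp (a i / m)"] by auto
  then have "?M / m \<le> ln ?S"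
    using S by (simp add: ln_ge_iff)
  then show "?M \<le> m * ln ?S"
    using m by (simp add: divide_le_eq mult.commute)
  have "?S \<le> (\<Sum>i\<in>I. exp (?M / m))"
    using I m by (intro sum_mono) (simp add: divide_right_mono)
  then have "ln ?S \<le> ln (card I * exp (?M / m))"
    using S by simp
  also have "\<dots> = ln (card I) + ?M / m"
    using I by (subst ln_mult) (auto simp: card_gt_0_iff)
  finally have "m * ln ?S \<le> m * (ln (card I) + ?M / m)"
    using m by simp
  then show "m * ln ?S \<le> ?M + m * ln (card I)"
    using m by (simp add: algebra_simps)
qed

lemma softplus_bounds:
  fixes s m :: real
  assumes "0 < m"
  shows "max s 0 \<le> m * ln (1 + exp (s / m))" "m * ln (1 + exp (s / m)) \<le> max s 0 + m * ln 2"
proof -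
  let ?a = "\<lambda>b. if b then s else 0"
  have "m * ln (1 + exp (s / m)) = m * ln (\<Sum>b\<in>UNIV. exp (?a b / m))"
    by (simp add: UNIV_bool)
  moreover have "Max (?a ` UNIV) = max s 0"
    by (simp add: UNIV_bool max.commute)
  ultimately show "max s 0 \<le> m * ln (1 + exp (s / m))" "m * ln (1 + exp (s / m)) \<le> max s 0 + m * ln 2"
    using log_sum_exp_bounds[of UNIV m ?a] assms by simp_all
qed

subsection \<open>The smoothing function of the model\<close>

lemma closed_convex_feasible:
  "closed (feasible :: 'd::finite var set)" "convex (feasible :: 'd::finite var set)"
proof -
  have simplex: "unit_simplex = {x::(real,'d) vec. (\<Sum>i\<in>UNIV. x $ i) = 1} \<inter> (\<Inter>i. {x. 0 \<le> x $ i})"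
    by (auto simp: unit_simplex_def)
  have psd: "{\<Lambda>. pos_semidef \<Lambda>} =
      (\<Inter>i j. {\<Lambda>::'d rmat. \<Lambda> $ j $ i = \<Lambda> $ i $ j}) \<inter> (\<Inter>v. {\<Lambda>. 0 \<le> v \<bullet> (\<Lambda> *v v)})"
    by (auto simp: pos_semidef_def transpose_def vec_eq_iff)
  have "closed (unit_simplex :: (real,'d) vec set)"
    unfolding simplex
    by (intro closed_Int closed_INT ballI closed_Collect_eq closed_Collect_le continuous_intros)
  moreover have "closed {\<Lambda>::'d rmat. pos_semidef \<Lambda>}"
    unfolding psd matrix_vector_mult_def inner_vec_def
    by (intro closed_Int closed_INT ballI closed_Collect_eq closed_Collect_le continuous_intros)
  ultimately show "closed (feasible :: 'd var set)"
    unfolding feasible_def by (intro closed_Times closed_UNIV)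
  have "convex (unit_simplex :: (real,'d) vec set)"
  proof (rule convexI)
    fix x y :: "(real,'d) vec" and u v :: real
    assume "x \<in> unit_simplex" "y \<in> unit_simplex" "0 \<le> u" "0 \<le> v" "u + v = 1"
    then show "u *\<^sub>R x + v *\<^sub>R y \<in> unit_simplex"
      unfolding unit_simplex_def by (simp add: sum.distrib flip: sum_distrib_left)
  qed
  moreover have "convex {\<Lambda>::'d rmat. pos_semidef \<Lambda>}"
  proof (rule convexI)
    fix A B :: "'d rmat" and u v :: real
    assume "A \<in> {\<Lambda>. pos_semidef \<Lambda>}" "B \<in> {\<Lambda>. pos_semidef \<Lambda>}" and uv: "0 \<le> u" "0 \<le> v"
    then have sym: "A $ j $ i = A $ i $ j" "B $ j $ i = B $ i $ j"
      and pos: "0 \<le> w \<bullet> (A *v w)" "0 \<le> w \<bullet> (B *v w)" for i j w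
      by (simp_all add: pos_semidef_def transpose_def vec_eq_iff)
    have "(u *\<^sub>R A + v *\<^sub>R B) $ j $ i = (u *\<^sub>R A + v *\<^sub>R B) $ i $ j" for i j
      using sym[of i j] by simp
    moreover have "0 \<le> w \<bullet> ((u *\<^sub>R A + v *\<^sub>R B) *v w)" for w
      using pos[of w] uv
      by (simp add: matrix_vector_mult_add_rdistrib inner_add_right flip: scaleR_matrix_vector_assoc)
    ultimately show "u *\<^sub>R A + v *\<^sub>R B \<in> {\<Lambda>. pos_semidef \<Lambda>}"
      unfolding psd by blast
  qed
  ultimately show "convex (feasible :: 'd var set)"
    unfolding feasible_def by (intro convex_Times convex_UNIV)
qed

lemma smooth_convex_psi_smooth:
  assumes "0 < m"
  shows "smooth_convex (psi_smooth l m)"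
proof (cases l)
  case Absolute
  then have "psi_smooth l m = (\<lambda>c. sqrt ((norm c)\<^sup>2 + m))"
    by (simp add: fun_eq_iff)
  then show ?thesis
    by (simp only: smooth_convex_sqrt_norm_power2_add[OF assms])
next
  case Quadratic
  then have "psi_smooth l m = (\<lambda>c. (norm c)\<^sup>2)"
    by (simp add: fun_eq_iff)
  then show ?thesis
    by (simp only: smooth_convex_norm_power2)
qed

lemma psi_smooth_bounds:
  assumes "0 \<le> m"
  shows "psi l c \<le> psi_smooth l m c" "psi_smooth l m c \<le> psi l c + sqrt m"
proof -
  show "psi l c \<le> psi_smooth l m c"
    using assms by (cases l) (auto intro: real_le_rsqrt)
  show "psi_smooth l m c \<le> psi l c + sqrt m"
    using assms sqrt_add_le_add_sqrt[of "c\<^sup>2" m] by (cases l) auto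
qed

context
  fixes P :: "'d::finite model"
  assumes Sigma: "pos_semidef (Sigma_hat P)"
    and kappa1: "0 \<le> kappa1 P" and tau: "0 \<le> tau1 P" "0 \<le> tau2 P" and beta: "beta P < 1"
begin

lemma kappa1_quadratic_form:
  "kappa1 P * (z \<bullet> (Sigma_hat P *v z)) = (norm (sqrt (kappa1 P) *\<^sub>R (mat_sqrt (Sigma_hat P) *v z)))\<^sup>2"
  using kappa1 by (simp add: norm_mat_sqrt_mult[OF Sigma, symmetric] power_mult_distrib)

lemma smooth_convex_h_smooth:
  assumes m: "0 < m"
  shows "smooth_convex (\<lambda>\<nu>. h_smooth P m \<nu> \<xi>)"
proof -
  let ?x = "\<lambda>\<nu>::'d var. fst \<nu>" and ?\<alpha> = "\<lambda>\<nu>::'d var. fst (snd \<nu>)"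
    and ?q = "\<lambda>\<nu>::'d var. fst (snd (snd \<nu>))" and ?\<Lambda> = "\<lambda>\<nu>::'d var. snd (snd (snd \<nu>))"
  let ?L = "\<lambda>\<nu>. (kappa2 P *\<^sub>R Sigma_hat P) \<bullet> ?\<Lambda> \<nu>
     + (transpose (?\<Lambda> \<nu>) *v mu_hat P + ?q \<nu>) \<bullet> mu_hat P + tau2 P * ?\<alpha> \<nu>
     - (transpose (?\<Lambda> \<nu>) *v \<xi> + ?q \<nu>) \<bullet> \<xi>"
  let ?z = "\<lambda>\<nu>. sqrt (kappa1 P) *\<^sub>R (mat_sqrt (Sigma_hat P) *v (?q \<nu> + 2 *\<^sub>R (?\<Lambda> \<nu> *v mu_hat P)))"
  note matrix_simps = matrix_vector_right_distrib matrix_vector_mult_scaleR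
    matrix_vector_mult_add_rdistrib scaleR_matrix_vector_assoc[symmetric]
    inner_add_left inner_add_right dot_lmul_matrix algebra_simps
  have L: "linear ?L" by (rule linearI) (simp_all add: matrix_simps)
  have z: "linear ?z" by (rule linearI) (simp_all add: matrix_simps)
  have "linear ?x" by (rule linearI) simp_all
  have r: "linear (\<lambda>\<nu>. - (part_B \<xi> \<bullet> ?x \<nu>))" by (rule linearI) (simp_all add: matrix_simps)
  have s: "linear (\<lambda>\<nu>. - (?x \<nu> \<bullet> part_B \<xi>) - ?\<alpha> \<nu>)" by (rule linearI) (simp_all add: matrix_simps)
  have eq: "h_smooth P m \<nu> \<xi> = ?L \<nu> + tau1 P * (norm (?x \<nu> + 0))\<^sup>2 + sqrt ((norm (?z \<nu> + 0))\<^sup>2 + m)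
      + psi_smooth (loss P) m (- (part_B \<xi> \<bullet> ?x \<nu>) + part_a \<xi>)
      + tau2 P / (1 - beta P) * (m * ln (1 + exp ((- (?x \<nu> \<bullet> part_B \<xi>) - ?\<alpha> \<nu> + 0) / m)))" for \<nu>
  proof -
    obtain x \<alpha> q \<Lambda> where "\<nu> = (x, \<alpha>, q, \<Lambda>)" by (cases \<nu>)
    then show ?thesis
      by (simp only: fst_conv snd_conv h_smooth.simps h1.simps kappa1_quadratic_form add_0_right) simp
  qed
  show ?thesis
    unfolding eq
    by (intro smooth_convex_add smooth_convex_cmul tau divide_nonneg_pos
        smooth_convex_linear[OF L]
        smooth_convex_compose_affine[OF smooth_convex_norm_power2 \<open>linear ?x\<close>]
        smooth_convex_compose_affine[OF smooth_convex_sqrt_norm_power2_add[OF m] z]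
        smooth_convex_compose_affine[OF smooth_convex_psi_smooth[OF m] r]
        smooth_convex_compose_affine[OF smooth_convex_softplus[OF m] s])
      (use beta in simp)
qed

lemma h_smooth_bounds:
  assumes m: "0 < m"
  shows "h P \<nu> \<xi> \<le> h_smooth P m \<nu> \<xi>"
    and "h_smooth P m \<nu> \<xi> \<le> h P \<nu> \<xi> + (2 * sqrt m + tau2 P / (1 - beta P) * (m * ln 2))"
proof -
  obtain x \<alpha> q \<Lambda> where \<nu>: "\<nu> = (x, \<alpha>, q, \<Lambda>)" by (cases \<nu>)
  let ?z = "q + 2 *\<^sub>R (\<Lambda> *v mu_hat P)" and ?s = "- (x \<bullet> part_B \<xi>) - \<alpha>" and ?c = "tau2 P / (1 - beta P)"
  let ?n = "norm (sqrt (kappa1 P) *\<^sub>R (mat_sqrt (Sigma_hat P) *v ?z))"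
  have c: "0 \<le> ?c" using tau beta by simp
  have n: "?n = sqrt (kappa1 P) * norm (mat_sqrt (Sigma_hat P) *v ?z)" using kappa1 by simp
  have "?n \<le> sqrt (?n\<^sup>2 + m)"
    using m by (intro real_le_rsqrt) simp
  moreover have "sqrt (?n\<^sup>2 + m) \<le> ?n + sqrt m"
    using sqrt_add_le_add_sqrt[of "?n\<^sup>2" m] m by simp
  moreover have "?c * max ?s 0 \<le> ?c * (m * ln (1 + exp (?s / m)))"
    using c softplus_bounds(1)[OF m] by (rule mult_left_mono[rotated])
  moreover have "?c * (m * ln (1 + exp (?s / m))) \<le> ?c * (max ?s 0 + m * ln 2)"
    using c softplus_bounds(2)[OF m] by (rule mult_left_mono[rotated])
  moreover have "?c * (max ?s 0 + m * ln 2) = ?c * max ?s 0 + ?c * (m * ln 2)"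
    by (rule distrib_left)
  moreover have "h P \<nu> \<xi> = h1 P \<nu> + ?n + psi (loss P) (part_a \<xi> - part_B \<xi> \<bullet> x)
      - (transpose \<Lambda> *v \<xi> + q) \<bullet> \<xi> + ?c * max ?s 0"
    by (simp only: \<nu> h.simps n)
  moreover have "h_smooth P m \<nu> \<xi> = h1 P \<nu> + sqrt (?n\<^sup>2 + m)
      + psi_smooth (loss P) m (part_a \<xi> - part_B \<xi> \<bullet> x)
      - (transpose \<Lambda> *v \<xi> + q) \<bullet> \<xi> + ?c * (m * ln (1 + exp (?s / m)))"
    by (simp only: \<nu> h_smooth.simps kappa1_quadratic_form) simp
  moreover note psi_smooth_bounds[OF less_imp_le[OF m], of "loss P" "part_a \<xi> - part_B \<xi> \<bullet> x"]
  ultimately show "h P \<nu> \<xi> \<le> h_smooth P m \<nu> \<xi>"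
    "h_smooth P m \<nu> \<xi> \<le> h P \<nu> \<xi> + (2 * sqrt m + ?c * (m * ln 2))"
    by linarith+
qed

lemma smooth_convex_phi_smooth:
  assumes "0 < m" "1 \<le> N"
  shows "smooth_convex (phi_smooth P N \<xi> m)"
  unfolding phi_smooth_def
  using smooth_convex_log_sum_exp[OF _ _ assms(1) smooth_convex_h_smooth[OF assms(1)], of "{1..N}" \<xi>] assms(2)
  by simp

lemma phi_smooth_error:
  assumes m: "0 < m" and N: "1 \<le> N"
  shows "\<bar>phi_smooth P N \<xi> m \<nu> - phi P N \<xi> \<nu>\<bar>
    \<le> 2 * sqrt m + tau2 P / (1 - beta P) * (m * ln 2) + m * ln N"
proof -
  let ?e = "2 * sqrt m + tau2 P / (1 - beta P) * (m * ln 2)"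
  let ?M = "Max ((\<lambda>i. h_smooth P m \<nu> (\<xi> i)) ` {1..N})"
  have I: "finite {1..N}" "{1..N} \<noteq> {}" using N by auto
  note lse = log_sum_exp_bounds[OF I m, of "\<lambda>i. h_smooth P m \<nu> (\<xi> i)", folded phi_smooth_def]
  have le: "h P \<nu> (\<xi> i) \<le> phi P N \<xi> \<nu>" if "i \<in> {1..N}" for i
    using that unfolding phi_def by (intro Max_ge) auto
  have "phi P N \<xi> \<nu> \<le> ?M"
    unfolding phi_def
  proof (rule Max.boundedI)
    fix a assume "a \<in> (\<lambda>i. h P \<nu> (\<xi> i)) ` {1..N}"
    then obtain i where i: "i \<in> {1..N}" "a = h P \<nu> (\<xi> i)" by auto
    have "h_smooth P m \<nu> (\<xi> i) \<le> ?M"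
      using i by (intro Max_ge) auto
    with h_smooth_bounds(1)[OF m, of \<nu> "\<xi> i"] i(2) show "a \<le> ?M" by linarith
  qed (use N in auto)
  moreover have "?M \<le> phi P N \<xi> \<nu> + ?e"
  proof (rule Max.boundedI)
    fix a assume "a \<in> (\<lambda>i. h_smooth P m \<nu> (\<xi> i)) ` {1..N}"
    then obtain i where i: "i \<in> {1..N}" "a = h_smooth P m \<nu> (\<xi> i)" by auto
    with h_smooth_bounds(2)[OF m, of \<nu> "\<xi> i"] le[OF i(1)] show "a \<le> phi P N \<xi> \<nu> + ?e" by linarith
  qed (use N in auto)
  moreover have "0 \<le> ?e" "0 \<le> m * ln N"
    using m N tau beta by auto
  moreover have "phi_smooth P N \<xi> m \<nu> \<le> ?M + m * ln N"
    using lse(2) by simp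
  ultimately show ?thesis
    using lse(1) by linarith
qed

end

theorem theorem5p8:
  fixes P :: "'d::finite model"
    and \<Xi> :: "'d rvec set"
    and N M n0 :: nat
    and \<xi> \<zeta> :: "nat \<Rightarrow> 'd rvec"
    and a0 \<sigma> \<rho> \<omega> \<eta> \<epsilon> :: real
    and \<mu> :: "nat \<Rightarrow> real"
    and \<nu> :: "nat \<Rightarrow> 'd var"
    and \<nu>_star :: "'d var"
  assumes Xi: "convex \<Xi>" "compact \<Xi>"
    and samples: "1 \<le> N" "\<And>i. i \<in> {1..N} \<Longrightarrow> \<xi> i \<in> \<Xi>"
    and history: "1 \<le> M" "\<And>j. j \<in> {1..M} \<Longrightarrow> \<zeta> j \<in> \<Xi>"
      "mu_hat P = sample_mean M \<zeta>"
      "Sigma_hat P = sample_cov (real M) M \<zeta> \<or> Sigma_hat P = sample_cov (real M - 1) M \<zeta>"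
      "pos_def (Sigma_hat P)"
    and model: "0 < kappa1 P" "0 < kappa2 P" "0 \<le> tau1 P" "0 \<le> tau2 P" "0 < beta P" "beta P < 1"
    and algorithm_parameters: "a0 \<in> {0<..<1}" "\<sigma> \<in> {0<..<1}" "\<rho> \<in> {0<..<1}" "\<omega> \<in> {0<..<1}"
      "0 < \<eta>" "0 < \<epsilon>" "1 \<le> n0"
    and generated: "spg_sequence feasible (phi_smooth P N \<xi>) a0 \<sigma> \<rho> \<omega> \<eta> \<epsilon> n0 \<mu> \<nu>"
    and accumulation_point: "\<nu>_star islimpt range \<nu>"
  shows "global_minimizer feasible (phi P N \<xi>) \<nu>_star"
proof (rule spg_accumulation_point_minimizes[OF closed_convex_feasible])
  have "0 \<le> v \<bullet> (Sigma_hat P *v v)" for v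
    using history(5) by (cases "v = 0") (auto simp: pos_def_def less_imp_le)
  with history(5) have Sigma: "pos_semidef (Sigma_hat P)"
    by (simp add: pos_def_def pos_semidef_def)
  note P = Sigma less_imp_le[OF model(1)] model(3,4,6)
  show "convex_on UNIV (phi_smooth P N \<xi> m)" "phi_smooth P N \<xi> m differentiable at x" if "0 < m" for m x
    using smooth_convex_phi_smooth[OF P that samples(1)] by (simp_all only: smooth_convex_def)
  show "\<bar>phi_smooth P N \<xi> m x - phi P N \<xi> x\<bar>
      \<le> 2 * sqrt m + tau2 P / (1 - beta P) * (m * ln 2) + m * ln N" if "0 < m" for m x
    by (rule phi_smooth_error[OF P that samples(1)])
  show "((\<lambda>m. 2 * sqrt m + tau2 P / (1 - beta P) * (m * ln 2) + m * ln N) \<longlongrightarrow> 0) (at_right 0)"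
    using model(6) by (auto intro!: tendsto_eq_intros)
qed (rule algorithm_parameters generated accumulation_point)+

end
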